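(* Let $n\ge 2$ and let $f:\mathbb{R}_+\to\mathbb{R}$ be smooth on $(0,\infty)$ and satisfy $f(x)=O(x^2)$ as $x\to 0$, $f'(x)=O(x)$ as $x\to 0$, $f(x)=O(x^2)$ as $x\to\infty$, and, on $(0,\infty)$, $f''>0$ and $\frac{d^2}{dx^2}\left(\frac{f}{f'}\right)>0$. Then the sectional curvature of the Riemannian metric $$ds^2=\frac{dx_1^2}{f(x_1)}+\cdots+\frac{dx_n^2}{f(x_n)}-\frac{(dx_1+\cdots+dx_n)^2}{f(x_1+\cdots+x_n)}$$ on $M=(0,\infty)^n$ is negative, i.e. for every point $p\in M$ and every two-dimensional subspace of $T_pM$ the sectional curvature is strictly negative.
   Context: The assumptions on $f$ imply $f>0$ and $f'>0$ on $(0,\infty)$, and that the displayed symmetric tensor is positive-definite, so it is a Riemannian metric on $M$. *)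

theory Defs
  imports "HOL-Analysis.Analysis" "HOL-Library.Landau_Symbols"
begin

(* To be used for open S only: both deriv and differentiable_on are then two-sided, and the
   values of f outside S play no role. *)
definition smooth_on :: "real set \<Rightarrow> (real \<Rightarrow> real) \<Rightarrow> bool" where
  "smooth_on S f \<longleftrightarrow> (\<forall>k. (deriv ^^ k) f differentiable_on S)"

text \<open>
  Riemannian geometry on an open subset of \<open>\<real>\<^sup>n\<close> in the standard coordinates.  All tangent spaces
  are identified with \<^typ>\<open>real^'n\<close>, and a metric is its matrix field \<open>g p $ i $ j = g\<^sub>i\<^sub>j(p)\<close>.  The
  definitions below are meaningful at a point around which \<open>g\<close> is smooth, symmetric and
  positive definite.
\<close>

definition partial_deriv :: "'n::finite \<Rightarrow> (real^'n \<Rightarrow> real) \<Rightarrow> real^'n \<Rightarrow> real" where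
  "partial_deriv i F p = deriv (\<lambda>t. F (p + t *\<^sub>R axis i 1)) 0"

definition metric_form :: "(real^'n \<Rightarrow> real^'n^'n) \<Rightarrow> real^'n \<Rightarrow> real^'n \<Rightarrow> real^'n \<Rightarrow> real" where
  "metric_form g p u v = (\<Sum>i\<in>UNIV. \<Sum>j\<in>UNIV. g p $ i $ j * u $ i * v $ j)"

(* christoffel g l i j is the component of \<nabla>_i \<partial>_j along \<partial>_l for the Levi-Civita connection \<nabla>. *)
definition christoffel ::
  "(real^'n \<Rightarrow> real^'n^'n) \<Rightarrow> 'n::finite \<Rightarrow> 'n \<Rightarrow> 'n \<Rightarrow> real^'n \<Rightarrow> real" where
  "christoffel g l i j p = (1/2) * (\<Sum>m\<in>UNIV. matrix_inv (g p) $ l $ m *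
     (partial_deriv i (\<lambda>q. g q $ j $ m) p + partial_deriv j (\<lambda>q. g q $ i $ m) p
      - partial_deriv m (\<lambda>q. g q $ i $ j) p))"

(* riemann_coeff g l i j k is the component of R(\<partial>_i, \<partial>_j) \<partial>_k along \<partial>_l, with the convention
   R(X,Y) Z = \<nabla>_X \<nabla>_Y Z - \<nabla>_Y \<nabla>_X Z - \<nabla>_[X,Y] Z. *)
definition riemann_coeff ::
  "(real^'n \<Rightarrow> real^'n^'n) \<Rightarrow> 'n::finite \<Rightarrow> 'n \<Rightarrow> 'n \<Rightarrow> 'n \<Rightarrow> real^'n \<Rightarrow> real" where
  "riemann_coeff g l i j k p =
     partial_deriv i (christoffel g l j k) p - partial_deriv j (christoffel g l i k) p
     + (\<Sum>m\<in>UNIV. christoffel g l i m p * christoffel g m j k p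
                - christoffel g l j m p * christoffel g m i k p)"

definition riemann_curvature ::
  "(real^'n \<Rightarrow> real^'n^'n) \<Rightarrow> real^'n \<Rightarrow> real^'n::finite \<Rightarrow> real^'n \<Rightarrow> real^'n \<Rightarrow> real^'n" where
  "riemann_curvature g p u v w =
     (\<chi> l. \<Sum>i\<in>UNIV. \<Sum>j\<in>UNIV. \<Sum>k\<in>UNIV. riemann_coeff g l i j k p * u $ i * v $ j * w $ k)"

(* Sectional curvature at p of the plane with basis u, v; it depends only on that plane.  With
   the sign convention for R above, the round sphere has positive curvature. *)
definition sectional_curvature ::
  "(real^'n \<Rightarrow> real^'n^'n) \<Rightarrow> real^'n \<Rightarrow> real^'n::finite \<Rightarrow> real^'n \<Rightarrow> real" where
  "sectional_curvature g p u v =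
     metric_form g p (riemann_curvature g p u v v) u
     / (metric_form g p u u * metric_form g p v v - (metric_form g p u v)\<^sup>2)"

definition positive_orthant :: "(real^'n) set" where
  "positive_orthant = {p. \<forall>i. 0 < p $ i}"

(* The matrix of  (\<Sum>i. dx_i^2 / f(x_i)) - (\<Sum>i. dx_i)^2 / f(\<Sum>i. x_i). *)
definition ds2 :: "(real \<Rightarrow> real) \<Rightarrow> real^'n::finite \<Rightarrow> real^'n^'n" where
  "ds2 f p = (\<chi> i j. (if i = j then 1 / f (p $ i) else 0) - 1 / f (\<Sum>k\<in>UNIV. p $ k))"

end

theory Submission
  imports Defs
begin

text \<open>
  Introduce coordinates \<open>y\<^sub>i\<close> with \<open>dy\<^sub>i = dx\<^sub>i / sqrt f(x\<^sub>i)\<close> for \<open>i = 0, ..., n\<close>.  The metric is the one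
  induced on the hypersurface \<open>x\<^sub>0 = x\<^sub>1 + ... + x\<^sub>n\<close> by the flat Lorentzian metric
  \<open>dy\<^sub>1\<^sup>2 + ... + dy\<^sub>n\<^sup>2 - dy\<^sub>0\<^sup>2\<close>.  The normal of this hypersurface is timelike, so by the Gauss equation the
  sectional curvature of a plane is minus the determinant of the second fundamental form on it,
  divided by that of the metric.  The Hessian of \<open>x\<^sub>0 - x\<^sub>1 - ... - x\<^sub>n\<close> in the flat coordinates is
  diagonal with entries \<open>f'(x\<^sub>0)/2, -f'(x\<^sub>1)/2, ..., -f'(x\<^sub>n)/2\<close>.  Hence the second fundamental form is
  a multiple of
  \<open>\<Sum> dx\<^sub>i\<^sup>2 / h(x\<^sub>i) - (\<Sum> dx\<^sub>i)\<^sup>2 / h(\<Sum> x\<^sub>i)\<close> with \<open>h = f / f'\<close>,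
  an expression of the same form as the metric itself.

  Such a form is positive definite if \<open>h(x\<^sub>1) + ... + h(x\<^sub>n) < h(x\<^sub>1 + ... + x\<^sub>n)\<close>, by the
  Cauchy-Schwarz inequality (\<open>rank_one_defect_pos\<close>).  This strict superadditivity holds for every
  strictly convex function on the half-line that tends to zero at the origin
  (\<open>superadditive_of_strict_mono_deriv\<close>).  It applies to \<open>f\<close>, which makes the metric Riemannian, and
  to \<open>h\<close>, where \<open>0 < h(x) < x\<close> because \<open>f\<close> is convex and vanishes at the origin.

  The embedding serves only to guess the formulas.  The proof works in the coordinates \<open>x\<^sub>i\<close>: the
  Christoffel symbols are computed in closed form (\<open>christoffel_ds2\<close>), they exhibit the second
  fundamental form and the normal, and the derivative of the normal is the shape operator
  (\<open>DERIV_normal\<close>).  In the curvature tensor all terms without the shape operator cancel, which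
  leaves the Gauss equation (\<open>gauss_equation\<close>).
\<close>

section \<open>Strict superadditivity of convex functions\<close>

lemma strict_mono_on_of_deriv_pos:
  fixes \<phi> \<phi>' :: "real \<Rightarrow> real"
  assumes deriv: "\<And>x. x > 0 \<Longrightarrow> (\<phi> has_real_derivative \<phi>' x) (at x)"
    and pos: "\<And>x. x > 0 \<Longrightarrow> \<phi>' x > 0"
  shows "strict_mono_on {0<..} \<phi>"
proof (rule strict_mono_onI)
  fix s t :: real
  assume "s \<in> {0<..}" "s < t"
  show "\<phi> s < \<phi> t"
  proof (rule DERIV_pos_imp_increasing[OF \<open>s < t\<close>])
    fix r assume "s \<le> r" "r \<le> t"
    then have "r > 0" using \<open>s \<in> {0<..}\<close> by simp
    then show "\<exists>d. (\<phi> has_real_derivative d) (at r) \<and> d > 0" using deriv pos by blast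
  qed
qed

lemma strict_mono_on_gt_right_limit:
  fixes \<phi> :: "real \<Rightarrow> real"
  assumes mono: "strict_mono_on {0<..} \<phi>" and lim: "(\<phi> \<longlongrightarrow> L) (at_right 0)" and "x > 0"
  shows "L < \<phi> x"
proof -
  have incr: "\<phi> s < \<phi> t" if "0 < s" "s < t" for s t
    using mono that by (auto simp: strict_mono_on_def)
  have "\<forall>\<^sub>F t in at_right 0. \<phi> t \<le> \<phi> (x / 2)"
    using incr \<open>x > 0\<close> by (auto simp: eventually_at_right_field less_imp_le intro!: exI[of _ "x / 2"])
  \<comment> \<open>The limit is compared with \<open>\<phi> (x / 2)\<close> because limits preserve only weak inequalities.\<close>
  then have "L \<le> \<phi> (x / 2)"
    using tendsto_upperbound[OF lim] by simp
  also have "\<dots> < \<phi> x" using incr \<open>x > 0\<close> by simp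
  finally show ?thesis .
qed

text \<open>
  A strictly convex function vanishing at the origin is strictly superadditive: the increment
  \<open>h (t + y) - h t\<close> grows with \<open>t\<close> and tends to \<open>h y\<close> as \<open>t\<close> tends to zero.
\<close>

lemma superadditive_of_strict_mono_deriv:
  fixes h h' :: "real \<Rightarrow> real"
  assumes deriv: "\<And>x. x > 0 \<Longrightarrow> (h has_real_derivative h' x) (at x)"
    and mono: "strict_mono_on {0<..} h'"
    and lim: "(h \<longlongrightarrow> 0) (at_right 0)"
    and "x > 0" "y > 0"
  shows "h x + h y < h (x + y)"
proof -
  have incr: "strict_mono_on {0<..} (\<lambda>t. h (t + y) - h t)"
  proof (rule strict_mono_on_of_deriv_pos)
    fix t :: real
    assume "t > 0"
    then show "((\<lambda>t. h (t + y) - h t) has_real_derivative h' (t + y) - h' t) (at t)"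
      using \<open>y > 0\<close> by (auto intro!: derivative_eq_intros DERIV_chain2[OF deriv] deriv)
    show "h' (t + y) - h' t > 0"
      using mono \<open>t > 0\<close> \<open>y > 0\<close> by (auto simp: strict_mono_on_def)
  qed
  have "isCont h y" using deriv[OF \<open>y > 0\<close>] by (rule DERIV_isCont)
  then have "((\<lambda>t. h (t + y)) \<longlongrightarrow> h y) (at 0)"
    by (simp add: isCont_iff add.commute)
  then have "((\<lambda>t. h (t + y)) \<longlongrightarrow> h y) (at_right 0)"
    by (rule tendsto_mono[OF at_le, rotated]) auto
  then have "((\<lambda>t. h (t + y) - h t) \<longlongrightarrow> h y) (at_right 0)"
    using tendsto_diff[OF _ lim] by fastforce
  from strict_mono_on_gt_right_limit[OF incr this \<open>x > 0\<close>] show ?thesis by simp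
qed

text \<open>
  The inequality is strict as soon as there are two summands, and this is where the dimension
  restriction \<open>n \<ge> 2\<close> is felt.
\<close>

lemma superadditive_sum:
  fixes h :: "real \<Rightarrow> real"
  assumes super: "\<And>x y. x > 0 \<Longrightarrow> y > 0 \<Longrightarrow> h x + h y < h (x + y)"
    and "finite A" "card A \<ge> 2" "\<And>i. i \<in> A \<Longrightarrow> x i > 0"
  shows "(\<Sum>i\<in>A. h (x i)) < h (\<Sum>i\<in>A. x i)"
proof -
  have weak: "(\<Sum>i\<in>B. h (x i)) \<le> h (\<Sum>i\<in>B. x i)"
    if "finite B" "B \<noteq> {}" "\<And>i. i \<in> B \<Longrightarrow> x i > 0" for B
    using that
  proof (induction B rule: finite_ne_induct)
    case (insert a B)
    have "(\<Sum>i\<in>insert a B. h (x i)) \<le> h (x a) + h (\<Sum>i\<in>B. x i)"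
      using insert by simp
    also have "\<dots> \<le> h (x a + (\<Sum>i\<in>B. x i))"
      using insert by (intro less_imp_le super sum_pos) auto
    finally show ?case using insert by simp
  qed simp
  obtain a where a: "a \<in> A" using assms by fastforce
  have ne: "A - {a} \<noteq> {}"
  proof
    assume "A - {a} = {}"
    then have "A = {a}" using a by blast
    then show False using assms by simp
  qed
  have "(\<Sum>i\<in>A. h (x i)) = h (x a) + (\<Sum>i\<in>A - {a}. h (x i))"
    using assms a by (simp add: sum.remove)
  also have "\<dots> \<le> h (x a) + h (\<Sum>i\<in>A - {a}. x i)"
    using weak[of "A - {a}"] ne assms by simp
  also have "\<dots> < h (x a + (\<Sum>i\<in>A - {a}. x i))"
    using ne assms a by (intro super sum_pos) auto
  also have "\<dots> = h (\<Sum>i\<in>A. x i)"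
    using assms a by (simp add: sum.remove)
  finally show ?thesis .
qed

section \<open>Diagonal forms with a rank-one defect\<close>

text \<open>
  By the Cauchy-Schwarz inequality \<open>(\<Sum>w\<^sub>i)\<^sup>2 \<le> (\<Sum>w\<^sub>i\<^sup>2/a\<^sub>i) (\<Sum>a\<^sub>i)\<close>, and the last factor is less than \<open>A\<close>.
\<close>

lemma rank_one_defect_pos:
  fixes w a :: "'i \<Rightarrow> real"
  assumes "finite I" and a: "\<And>i. i \<in> I \<Longrightarrow> a i > 0" and A: "(\<Sum>i\<in>I. a i) < A"
    and w: "\<exists>i\<in>I. w i \<noteq> 0"
  shows "0 < (\<Sum>i\<in>I. (w i)\<^sup>2 / a i) - (\<Sum>i\<in>I. w i)\<^sup>2 / A"
proof -
  obtain k where k: "k \<in> I" "w k \<noteq> 0" using w by blast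
  have pos: "(\<Sum>i\<in>I. (w i)\<^sup>2 / a i) > 0"
    using k a \<open>finite I\<close> by (intro sum_pos2[of I k]) (auto simp: less_imp_le)
  have "A > 0" using A sum_nonneg[of I a] a by (smt (verit))
  have "(\<Sum>i\<in>I. w i)\<^sup>2 = (\<Sum>i\<in>I. (w i / sqrt (a i)) * sqrt (a i))\<^sup>2"
    by (intro arg_cong[where f = "\<lambda>z. z\<^sup>2"] sum.cong) (auto dest!: a)
  also have "\<dots> \<le> (\<Sum>i\<in>I. (w i / sqrt (a i))\<^sup>2) * (\<Sum>i\<in>I. (sqrt (a i))\<^sup>2)"
    by (rule Cauchy_Schwarz_ineq_sum)
  also have "\<dots> = (\<Sum>i\<in>I. (w i)\<^sup>2 / a i) * (\<Sum>i\<in>I. a i)"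
    using a by (simp add: power_divide less_imp_le)
  also have "\<dots> < (\<Sum>i\<in>I. (w i)\<^sup>2 / a i) * A"
    using pos A by simp
  finally show ?thesis using \<open>A > 0\<close> by (simp add: field_simps)
qed

lemma metric_form_ds2:
  "metric_form (ds2 a) p u v
   = (\<Sum>i\<in>UNIV. u $ i * v $ i / a (p $ i)) - (\<Sum>i\<in>UNIV. u $ i) * (\<Sum>i\<in>UNIV. v $ i) / a (\<Sum>k\<in>UNIV. p $ k)"
proof -
  have "metric_form (ds2 a) p u v
      = (\<Sum>i\<in>UNIV. \<Sum>j\<in>UNIV. (if i = j then u $ i * v $ i / a (p $ i) else 0)
          - u $ i * v $ j / a (\<Sum>k\<in>UNIV. p $ k))"
    unfolding metric_form_def ds2_def
    by (intro sum.cong refl) (simp add: algebra_simps)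
  also have "\<dots> = (\<Sum>i\<in>UNIV. u $ i * v $ i / a (p $ i))
      - (\<Sum>i\<in>UNIV. u $ i) * (\<Sum>i\<in>UNIV. v $ i) / a (\<Sum>k\<in>UNIV. p $ k)"
    by (simp add: sum_subtractf sum_product sum_divide_distrib)
  finally show ?thesis .
qed

lemma metric_form_ds2_pos:
  assumes "\<And>i. a (p $ i) > 0" and "(\<Sum>i\<in>UNIV. a (p $ i)) < a (\<Sum>i\<in>UNIV. p $ i)" and "w \<noteq> 0"
  shows "metric_form (ds2 a) p w w > 0"
proof -
  have "\<exists>i\<in>UNIV. w $ i \<noteq> 0" using \<open>w \<noteq> 0\<close> by (auto simp: vec_eq_iff)
  from rank_one_defect_pos[OF finite assms(1,2) this]
  show ?thesis by (simp add: metric_form_ds2 power2_eq_square)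
qed

text \<open>
  The strict Cauchy-Schwarz inequality of a positive definite form \<open>Q\<close>, obtained by evaluating \<open>Q\<close>
  at \<open>Q(v,v) u - Q(u,v) v\<close>, a nonzero multiple of the component of \<open>u\<close> orthogonal to \<open>v\<close>.  With
  \<open>a = f\<close> it says that the denominator of the sectional curvature is positive, and with
  \<open>a = f / f'\<close> that the determinant of the second fundamental form on a plane is.
\<close>

lemma metric_form_ds2_gram_pos:
  assumes pos: "\<And>i. a (p $ i) > 0" "(\<Sum>i\<in>UNIV. a (p $ i)) < a (\<Sum>i\<in>UNIV. p $ i)"
    and indep: "independent {u, v}" "u \<noteq> v"
  shows "(metric_form (ds2 a) p u v)\<^sup>2 < metric_form (ds2 a) p u u * metric_form (ds2 a) p v v"
proof -
  define Q where "Q = metric_form (ds2 a) p"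
  have Qpos: "Q w w > 0" if "w \<noteq> 0" for w
    unfolding Q_def using metric_form_ds2_pos[OF pos that] .
  have "v \<noteq> 0" using indep by (metis dependent_zero insertCI)
  have "u \<noteq> (Q u v / Q v v) *\<^sub>R v"
  proof
    assume "u = (Q u v / Q v v) *\<^sub>R v"
    then have "u \<in> span {v}" by (metis span_base span_scale insertI1)
    then show False using indep by (simp add: independent_insert)
  qed
  moreover have "Q v v *\<^sub>R u - Q u v *\<^sub>R v = Q v v *\<^sub>R (u - (Q u v / Q v v) *\<^sub>R v)"
    using Qpos[OF \<open>v \<noteq> 0\<close>] by (simp add: scaleR_diff_right)
  ultimately have "Q (Q v v *\<^sub>R u - Q u v *\<^sub>R v) (Q v v *\<^sub>R u - Q u v *\<^sub>R v) > 0"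
    using Qpos[OF \<open>v \<noteq> 0\<close>] by (intro Qpos) auto
  also have "Q (Q v v *\<^sub>R u - Q u v *\<^sub>R v) (Q v v *\<^sub>R u - Q u v *\<^sub>R v)
      = Q v v * (Q v v * Q u u - (Q u v)\<^sup>2)"
  proof -
    have lin: "Q (s *\<^sub>R x - t *\<^sub>R y) z = s * Q x z - t * Q y z" for s t x y z
      unfolding Q_def metric_form_def
      by (simp add: algebra_simps sum_subtractf sum_distrib_left)
    have sym: "Q x y = Q y x" for x y
      unfolding Q_def metric_form_ds2 by (simp add: mult.commute)
    have linr: "Q z (s *\<^sub>R x - t *\<^sub>R y) = s * Q z x - t * Q z y" for s t x y z
      using lin sym by metis
    show ?thesis
      unfolding lin linr sym[of v u] by (simp add: algebra_simps power2_eq_square)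
  qed
  finally show ?thesis
    using Qpos[OF \<open>v \<noteq> 0\<close>] by (simp add: zero_less_mult_iff Q_def mult.commute)
qed

section \<open>Partial derivatives of separable expressions\<close>

lemma open_positive_orthant: "open (positive_orthant :: (real^'n) set)"
proof -
  have "positive_orthant = (\<Inter>i. {p :: real^'n. 0 < p $ i})"
    by (auto simp: positive_orthant_def)
  also have "open \<dots>"
    by (intro open_INT ballI finite open_Collect_less continuous_intros)
  finally show ?thesis .
qed

lemma partial_deriv_cong_on_open:
  assumes "open S" "p \<in> S" "\<And>q. q \<in> S \<Longrightarrow> F q = G q"
  shows "partial_deriv i F p = partial_deriv i G p"
  unfolding partial_deriv_def
proof (rule deriv_cong_ev)
  have "((\<lambda>t. p + t *\<^sub>R axis i 1) \<longlongrightarrow> p) (nhds 0)"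
    by (auto intro!: tendsto_eq_intros filterlim_ident)
  then have "\<forall>\<^sub>F t in nhds 0. p + t *\<^sub>R axis i 1 \<in> S"
    using assms(1,2) by (rule topological_tendstoD)
  then show "\<forall>\<^sub>F t in nhds 0. F (p + t *\<^sub>R axis i 1) = G (p + t *\<^sub>R axis i 1)"
    by eventually_elim (rule assms(3))
qed simp

lemma DERIV_comp_coord:
  fixes p :: "real^'n"
  assumes "(a has_real_derivative d) (at (p $ j))"
  shows "((\<lambda>t. a ((p + t *\<^sub>R axis i 1) $ j)) has_real_derivative (if i = j then d else 0)) (at 0)"
proof -
  have "((\<lambda>t. (p + t *\<^sub>R axis i 1) $ j) has_real_derivative (if i = j then 1 else 0)) (at 0)"
    by (auto simp: axis_def intro!: derivative_eq_intros)
  from DERIV_chain2[OF _ this, of a d] assms show ?thesis by (auto simp: if_distrib cong: if_cong)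
qed

lemma DERIV_comp_coord_sum:
  fixes p :: "real^'n"
  assumes "(a has_real_derivative d) (at (\<Sum>k\<in>UNIV. p $ k))"
  shows "((\<lambda>t. a (\<Sum>k\<in>UNIV. (p + t *\<^sub>R axis i 1) $ k)) has_real_derivative d) (at 0)"
proof -
  have "(p + t *\<^sub>R axis i 1) $ k = p $ k + (if k = i then t else 0)" for t k
    by (simp add: axis_def)
  then have "(\<Sum>k\<in>UNIV. (p + t *\<^sub>R axis i 1) $ k) = (\<Sum>k\<in>UNIV. p $ k + (if k = i then t else 0))" for t
    by (intro sum.cong refl)
  then have "(\<Sum>k\<in>UNIV. (p + t *\<^sub>R axis i 1) $ k) = (\<Sum>k\<in>UNIV. p $ k) + t" for t
    by (subst (asm) sum.distrib) (simp del: vector_add_component)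
  moreover have "((\<lambda>t. (\<Sum>k\<in>UNIV. p $ k) + t) has_real_derivative 1) (at 0)"
    by (auto intro!: derivative_eq_intros)
  from DERIV_chain2[OF _ this, of a d] assms
  have "((\<lambda>t. a ((\<Sum>k\<in>UNIV. p $ k) + t)) has_real_derivative d) (at 0)" by simp
  ultimately show ?thesis by (simp only:)
qed

section \<open>The curvature tensor in closed form\<close>

lemma matrix_inv_eqI:
  fixes A B :: "real^'n^'n"
  assumes "A ** B = mat 1"
  shows "matrix_inv A = B"
proof -
  have "B ** A = mat 1"
    using assms by (simp add: matrix_left_right_inverse)
  then have "invertible A"
    using assms by (auto simp: invertible_def)
  then have "matrix_inv A ** A = mat 1"
    by (simp add: matrix_inv_def invertible_def) (metis (mono_tags, lifting) someI)
  then have "matrix_inv A ** (A ** B) = B"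
    by (simp add: matrix_mul_assoc)
  then show ?thesis using assms by simp
qed

lemma ds2_row_sum:
  "(\<Sum>k\<in>UNIV. ds2 a p $ i $ k * X k) = X i / a (p $ i) - (\<Sum>k\<in>UNIV. X k) / a (\<Sum>k\<in>UNIV. p $ k)"
proof -
  have "(\<Sum>k\<in>UNIV. ds2 a p $ i $ k * X k)
      = (\<Sum>k\<in>UNIV. (if i = k then X i / a (p $ i) else 0) - X k / a (\<Sum>k\<in>UNIV. p $ k))"
    by (intro sum.cong refl) (simp add: ds2_def algebra_simps)
  then show ?thesis by (simp add: sum_subtractf sum_divide_distrib)
qed

locale superadditive_profile =
  fixes f f' f'' :: "real \<Rightarrow> real"
  assumes pos: "x > 0 \<Longrightarrow> f x > 0"
    and deriv_pos: "x > 0 \<Longrightarrow> f' x > 0"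
    and deriv1: "x > 0 \<Longrightarrow> (f has_real_derivative f' x) (at x)"
    and deriv2: "x > 0 \<Longrightarrow> (f' has_real_derivative f'' x) (at x)"
    and superadd: "x > 0 \<Longrightarrow> y > 0 \<Longrightarrow> f x + f y < f (x + y)"
begin

text \<open>
  In the ambient flat space with coordinates \<open>y\<^sub>i\<close>, \<open>dy\<^sub>i = dx\<^sub>i / sqrt f(x\<^sub>i)\<close>, the hypersurface is
  \<open>x\<^sub>0 - x\<^sub>1 - ... - x\<^sub>n = 0\<close>, and \<open>gap\<close> is minus the square length of the gradient of the left-hand
  side.  Its positivity says that the normal is timelike.
\<close>

definition gap :: "real^'n \<Rightarrow> real" where
  "gap p = f (\<Sum>k\<in>UNIV. p $ k) - (\<Sum>k\<in>UNIV. f (p $ k))"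

text \<open>
  The matrix \<open>ds2 recip_log_deriv p\<close> has entries \<open>\<delta>\<^sub>i\<^sub>j f'(x\<^sub>i)/f(x\<^sub>i) - f'(s)/f(s)\<close>, where \<open>s\<close> is the sum of
  the coordinates.  It is the second fundamental form up to normalisation, so that this form has
  the same shape as the metric, with \<open>f / f'\<close> in place of \<open>f\<close>.
\<close>

definition recip_log_deriv :: "real \<Rightarrow> real" where
  "recip_log_deriv x = f x / f' x"

text \<open>
  The shape operator, up to normalisation: the second fundamental form
  \<open>ds2 recip_log_deriv p\<close> with one index raised by the metric.
\<close>

definition shape :: "'n \<Rightarrow> 'n \<Rightarrow> real^'n \<Rightarrow> real" where
  "shape l i p = (if l = i then f' (p $ i) else 0)
     + f (p $ l) / gap p * (f' (p $ i) - f' (\<Sum>k\<in>UNIV. p $ k))"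

lemma ds2_recip_log_deriv_entry:
  "ds2 recip_log_deriv p $ i $ j = (if i = j then f' (p $ i) / f (p $ i) else 0)
     - f' (\<Sum>k\<in>UNIV. p $ k) / f (\<Sum>k\<in>UNIV. p $ k)"
  by (simp add: ds2_def recip_log_deriv_def)

lemma sum_f_eq: "(\<Sum>k\<in>UNIV. f (p $ k)) = f (\<Sum>k\<in>UNIV. p $ k) - gap p"
  by (simp add: gap_def)

context
  fixes p :: "real^'n"
  assumes p: "p \<in> positive_orthant" and dim: "CARD('n) \<ge> 2"
begin

lemma coord_pos: "p $ i > 0"
  using p by (simp add: positive_orthant_def)

lemma coord_sum_pos: "(\<Sum>k\<in>UNIV. p $ k) > 0"
  by (intro sum_pos coord_pos) auto

lemma gap_pos: "gap p > 0"
  unfolding gap_def using superadditive_sum[of f UNIV "($) p"] superadd dim coord_pos by simp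

lemma coord_nonzero: "f (p $ i) \<noteq> 0" "f' (p $ i) \<noteq> 0" "f (\<Sum>k\<in>UNIV. p $ k) \<noteq> 0" "f' (\<Sum>k\<in>UNIV. p $ k) \<noteq> 0"
    "gap p \<noteq> 0"
  using pos deriv_pos coord_pos coord_sum_pos gap_pos by (metis less_irrefl)+

text \<open>
  The Sherman-Morrison formula for the inverse of a rank-one perturbation of a diagonal matrix.
\<close>

lemma matrix_inv_ds2:
  "matrix_inv (ds2 f p)
   = (\<chi> i j. (if i = j then f (p $ i) else 0) + f (p $ i) * f (p $ j) / gap p)"
proof (rule matrix_inv_eqI)
  have "(\<Sum>k\<in>UNIV. ds2 f p $ i $ k * ((if k = j then f (p $ k) else 0) + f (p $ k) * f (p $ j) / gap p))
      = (if i = j then 1 else 0)" for i j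
  proof -
    have col_sum: "(\<Sum>k\<in>UNIV. (if k = j then f (p $ k) else 0) + f (p $ k) * f (p $ j) / gap p)
        = f (p $ j) + (f (\<Sum>k\<in>UNIV. p $ k) - gap p) * f (p $ j) / gap p"
      unfolding sum.distrib sum_divide_distrib[symmetric] sum_distrib_right[symmetric] sum_f_eq by simp
    show ?thesis
      unfolding ds2_row_sum col_sum using coord_nonzero by (simp add: field_simps)
  qed
  then show "ds2 f p ** (\<chi> i j. (if i = j then f (p $ i) else 0) + f (p $ i) * f (p $ j) / gap p) = mat 1"
    by (simp add: vec_eq_iff matrix_matrix_mult_def mat_def)
qed

lemma partial_deriv_ds2:
  "partial_deriv i (\<lambda>q. ds2 f q $ j $ m) p
   = (if i = j \<and> j = m then - f' (p $ j) / (f (p $ j))\<^sup>2 else 0)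
     + f' (\<Sum>k\<in>UNIV. p $ k) / (f (\<Sum>k\<in>UNIV. p $ k))\<^sup>2"
proof -
  have inv: "((\<lambda>x. 1 / f x) has_real_derivative - f' x / (f x)\<^sup>2) (at x)" if "x > 0" for x
    using deriv1[OF that] pos[OF that] by (auto intro!: derivative_eq_intros simp: power2_eq_square)
  have "((\<lambda>t. if j = m then 1 / f ((p + t *\<^sub>R axis i 1) $ j) else 0) has_real_derivative
      (if i = j \<and> j = m then - f' (p $ j) / (f (p $ j))\<^sup>2 else 0)) (at 0)"
    using DERIV_comp_coord[OF inv[OF coord_pos], of i j] by (cases "j = m") auto
  from DERIV_diff[OF this DERIV_comp_coord_sum[OF inv[OF coord_sum_pos], of i]]
  show ?thesis unfolding partial_deriv_def ds2_def by (simp add: DERIV_imp_deriv)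
qed

text \<open>
  The first summand is the flat connection of the product metric \<open>\<Sum> dx\<^sub>i\<^sup>2 / f(x\<^sub>i)\<close>.  In the second, the
  factor \<open>f(x\<^sub>l) / gap p\<close> is the component along \<open>x\<^sub>l\<close> of a rescaled normal vector, and it
  multiplies the second fundamental form: the ambient derivative is projected to the hypersurface.
\<close>

lemma christoffel_ds2:
  "christoffel (ds2 f) l i j p
   = - (1/2) * ((if i = j \<and> j = l then f' (p $ l) / f (p $ l) else 0) + f (p $ l) / gap p * ds2 recip_log_deriv p $ i $ j)"
proof -
  \<comment> \<open>Twice the Christoffel symbol of the first kind.\<close>
  define X where "X m = (if i = j \<and> j = m then - f' (p $ m) / (f (p $ m))\<^sup>2 else 0)
     + f' (\<Sum>k\<in>UNIV. p $ k) / (f (\<Sum>k\<in>UNIV. p $ k))\<^sup>2" for m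
  have "partial_deriv i (\<lambda>q. ds2 f q $ j $ m) p + partial_deriv j (\<lambda>q. ds2 f q $ i $ m) p
      - partial_deriv m (\<lambda>q. ds2 f q $ i $ j) p = X m" for m
    unfolding partial_deriv_ds2 X_def by auto
  then have "christoffel (ds2 f) l i j p
      = (1/2) * (\<Sum>m\<in>UNIV. (if l = m then f (p $ l) * X l else 0) + f (p $ l) / gap p * (f (p $ m) * X m))"
    unfolding christoffel_def matrix_inv_ds2
    by (intro arg_cong2[where f = "(*)"] sum.cong refl) (simp add: algebra_simps)
  also have "\<dots> = (1/2) * (f (p $ l) * X l + f (p $ l) / gap p * (\<Sum>m\<in>UNIV. f (p $ m) * X m))"
    by (simp add: sum.distrib sum_distrib_left)
  also have "(\<Sum>m\<in>UNIV. f (p $ m) * X m)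
      = (\<Sum>m\<in>UNIV. (if j = m then (if i = j then - f' (p $ j) / f (p $ j) else 0) else 0)
          + f (p $ m) * (f' (\<Sum>k\<in>UNIV. p $ k) / (f (\<Sum>k\<in>UNIV. p $ k))\<^sup>2))"
    using coord_nonzero by (intro sum.cong refl) (auto simp: X_def algebra_simps power2_eq_square)
  also have "\<dots> = (if i = j then - f' (p $ j) / f (p $ j) else 0)
      + (f (\<Sum>k\<in>UNIV. p $ k) - gap p) * (f' (\<Sum>k\<in>UNIV. p $ k) / (f (\<Sum>k\<in>UNIV. p $ k))\<^sup>2)"
    unfolding sum.distrib sum_distrib_right[symmetric] sum_f_eq by simp
  finally have eq: "christoffel (ds2 f) l i j p = (1/2) * (f (p $ l) * X l + f (p $ l) / gap p *
      ((if i = j then - f' (p $ j) / f (p $ j) else 0)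
      + (f (\<Sum>k\<in>UNIV. p $ k) - gap p) * (f' (\<Sum>k\<in>UNIV. p $ k) / (f (\<Sum>k\<in>UNIV. p $ k))\<^sup>2)))" .
  show ?thesis
    unfolding eq unfolding X_def ds2_recip_log_deriv_entry using coord_nonzero
    by (simp add: power2_eq_square field_simps)
qed

text \<open>
  The Weingarten equation: the derivative of the rescaled normal is given by the shape operator.
\<close>

lemma DERIV_normal:
  "((\<lambda>t. f ((p + t *\<^sub>R axis i 1) $ l) / gap (p + t *\<^sub>R axis i 1)) has_real_derivative shape l i p / gap p) (at 0)"
proof -
  have "((\<lambda>t. gap (p + t *\<^sub>R axis i 1)) has_real_derivative
      f' (\<Sum>k\<in>UNIV. p $ k) - (\<Sum>k\<in>UNIV. if i = k then f' (p $ k) else 0)) (at 0)"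
    unfolding gap_def
    by (intro DERIV_diff DERIV_sum DERIV_comp_coord_sum DERIV_comp_coord deriv1 coord_pos coord_sum_pos)
  then have gap': "((\<lambda>t. gap (p + t *\<^sub>R axis i 1)) has_real_derivative f' (\<Sum>k\<in>UNIV. p $ k) - f' (p $ i)) (at 0)"
    by simp
  have "gap (p + 0 *\<^sub>R axis i 1) \<noteq> 0" using coord_nonzero by simp
  from DERIV_divide[OF DERIV_comp_coord[OF deriv1[OF coord_pos], of i l] gap' this]
  show ?thesis
    by (rule DERIV_cong) (use coord_nonzero in \<open>simp add: shape_def field_simps\<close>)
qed

end

text \<open>
  The Christoffel symbols are differentiated at \<open>p\<close> through their closed form at all nearby points,
  so the preceding facts are needed with the base point generalised.
\<close>

context
  fixes p :: "real^'n"
  assumes p: "p \<in> positive_orthant" and dim: "CARD('n) \<ge> 2"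
begin

lemma partial_deriv_christoffel:
  defines "c' x \<equiv> (f'' x * f x - f' x * f' x) / (f x * f x)"
  shows "partial_deriv i (christoffel (ds2 f) l j k) p
   = - (1/2) * ((if i = j \<and> j = k \<and> k = l then c' (p $ l) else 0)
       + shape l i p / gap p * ds2 recip_log_deriv p $ j $ k
       + f (p $ l) / gap p * ((if i = j \<and> j = k then c' (p $ j) else 0) - c' (\<Sum>k\<in>UNIV. p $ k)))"
proof -
  have c: "((\<lambda>x. f' x / f x) has_real_derivative c' x) (at x)" if "x > 0" for x
    unfolding c'_def using DERIV_divide[OF deriv2[OF that] deriv1[OF that]] pos[OF that] by simp
  note c_coord = DERIV_comp_coord[OF c[OF coord_pos[OF p dim]], of i]
  note c_sum = DERIV_comp_coord_sum[OF c[OF coord_sum_pos[OF p dim]], of i]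
  have d1: "((\<lambda>t. if j = k \<and> k = l then f' ((p + t *\<^sub>R axis i 1) $ l) / f ((p + t *\<^sub>R axis i 1) $ l) else 0)
      has_real_derivative (if i = j \<and> j = k \<and> k = l then c' (p $ l) else 0)) (at 0)"
    using c_coord[of l] by (cases "j = k \<and> k = l") auto
  have "((\<lambda>t. if j = k then f' ((p + t *\<^sub>R axis i 1) $ j) / f ((p + t *\<^sub>R axis i 1) $ j) else 0)
      has_real_derivative (if i = j \<and> j = k then c' (p $ j) else 0)) (at 0)"
    using c_coord[of j] by (cases "j = k") auto
  from DERIV_diff[OF this c_sum]
  have d2: "((\<lambda>t. ds2 recip_log_deriv (p + t *\<^sub>R axis i 1) $ j $ k) has_real_derivative
      (if i = j \<and> j = k then c' (p $ j) else 0) - c' (\<Sum>k\<in>UNIV. p $ k)) (at 0)"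
    by (simp only: ds2_recip_log_deriv_entry)
  have "partial_deriv i (christoffel (ds2 f) l j k) p
      = partial_deriv i (\<lambda>q. - (1/2) * ((if j = k \<and> k = l then f' (q $ l) / f (q $ l) else 0)
          + f (q $ l) / gap q * ds2 recip_log_deriv q $ j $ k)) p"
    using open_positive_orthant p by (rule partial_deriv_cong_on_open) (rule christoffel_ds2[OF _ dim])
  also have "\<dots> = - (1/2) * ((if i = j \<and> j = k \<and> k = l then c' (p $ l) else 0)
       + (shape l i p / gap p * ds2 recip_log_deriv p $ j $ k
       + ((if i = j \<and> j = k then c' (p $ j) else 0) - c' (\<Sum>k\<in>UNIV. p $ k)) * (f (p $ l) / gap p)))"
    unfolding partial_deriv_def
    by (rule trans[OF DERIV_imp_deriv[OF DERIV_cmult[OF DERIV_add[OF d1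
          DERIV_mult[OF DERIV_normal[OF p dim] d2]]]]]) simp
  finally show ?thesis by (simp add: algebra_simps)
qed

text \<open>
  The summands other than the one with the shape operator are symmetric in \<open>i\<close> and \<open>j\<close>, as in the
  derivative of the Christoffel symbols.  Hence they drop out of the curvature tensor.
\<close>

lemma christoffel_product:
  defines "c x \<equiv> f' x / f x"
  shows "(\<Sum>m\<in>UNIV. christoffel (ds2 f) l i m p * christoffel (ds2 f) m j k p)
   = (1/4) * ((if i = j \<and> j = k \<and> k = l then (c (p $ l))\<^sup>2 else 0)
       + shape l i p / gap p * ds2 recip_log_deriv p $ j $ k
       + f (p $ l) / gap p * ((if i = j \<and> j = k then (c (p $ i))\<^sup>2 else 0) - (c (\<Sum>k\<in>UNIV. p $ k))\<^sup>2))"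
proof -
  define X where "X m = (if j = k \<and> k = m then c (p $ m) else 0) + f (p $ m) / gap p * ds2 recip_log_deriv p $ j $ k" for m
  have sumX: "(\<Sum>m\<in>UNIV. X m)
      = (if j = k then c (p $ k) else 0) + (f (\<Sum>k\<in>UNIV. p $ k) - gap p) / gap p * ds2 recip_log_deriv p $ j $ k"
  proof -
    have "(\<Sum>m\<in>UNIV. X m) = (\<Sum>m\<in>UNIV. (if k = m then (if j = k then c (p $ k) else 0) else 0))
        + (\<Sum>m\<in>UNIV. f (p $ m)) / gap p * ds2 recip_log_deriv p $ j $ k"
      unfolding X_def sum_divide_distrib sum_distrib_right sum.distrib[symmetric]
      by (intro sum.cong) auto
    then show ?thesis by (simp add: sum_f_eq)
  qed
  have "(\<Sum>m\<in>UNIV. christoffel (ds2 f) l i m p * christoffel (ds2 f) m j k p)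
      = (\<Sum>m\<in>UNIV. (1/4) * ((if i = m then (if i = l then c (p $ l) * X i else 0) else 0)
          + f (p $ l) / gap p * (ds2 recip_log_deriv p $ i $ m * X m)))"
    unfolding christoffel_ds2[OF p dim] X_def c_def
    by (intro sum.cong refl) (simp add: algebra_simps)
  also have "\<dots> = (1/4) * ((if i = l then c (p $ l) * X i else 0)
      + f (p $ l) / gap p * (X i * c (p $ i) - (\<Sum>m\<in>UNIV. X m) * c (\<Sum>k\<in>UNIV. p $ k)))"
    unfolding sum_distrib_left[symmetric] sum.distrib ds2_row_sum by (simp add: recip_log_deriv_def c_def)
  finally have eq: "(\<Sum>m\<in>UNIV. christoffel (ds2 f) l i m p * christoffel (ds2 f) m j k p)
      = (1/4) * ((if i = l then c (p $ l) * X i else 0)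
      + f (p $ l) / gap p * (X i * c (p $ i) - (\<Sum>m\<in>UNIV. X m) * c (\<Sum>k\<in>UNIV. p $ k)))" .
  show ?thesis
    unfolding eq sumX unfolding X_def shape_def ds2_recip_log_deriv_entry c_def
    using coord_nonzero[OF p dim]
    by (simp add: field_simps power2_eq_square)
qed

lemma riemann_coeff_ds2:
  "riemann_coeff (ds2 f) l i j k p
   = - (1 / (4 * gap p)) * (shape l i p * ds2 recip_log_deriv p $ j $ k - shape l j p * ds2 recip_log_deriv p $ i $ k)"
  unfolding riemann_coeff_def sum_subtractf christoffel_product partial_deriv_christoffel
  using coord_nonzero(5)[OF p dim] by (cases "i = j") (simp_all add: field_simps)

text \<open>
  Lowering the index of the shape operator gives back the second fundamental form.
\<close>

lemma ds2_shape: "(\<Sum>l\<in>UNIV. ds2 f p $ r $ l * shape l i p) = ds2 recip_log_deriv p $ r $ i"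
proof -
  have col_sum: "(\<Sum>l\<in>UNIV. shape l i p)
      = f' (p $ i) + (f (\<Sum>k\<in>UNIV. p $ k) - gap p) / gap p * (f' (p $ i) - f' (\<Sum>k\<in>UNIV. p $ k))"
    unfolding shape_def sum.distrib sum_distrib_right[symmetric] sum_divide_distrib[symmetric] sum_f_eq
    by simp
  show ?thesis
    unfolding ds2_row_sum col_sum ds2_recip_log_deriv_entry using coord_nonzero[OF p dim]
    by (simp add: shape_def field_simps)
qed

text \<open>
  The Gauss equation for a spacelike hypersurface of a flat Lorentzian space.  The minus sign comes
  from the timelike normal.
\<close>

lemma gauss_equation:
  "metric_form (ds2 f) p (riemann_curvature (ds2 f) p u v v) u
   = - (1 / (4 * gap p)) *
      (metric_form (ds2 recip_log_deriv) p u u * metric_form (ds2 recip_log_deriv) p v v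
       - (metric_form (ds2 recip_log_deriv) p u v)\<^sup>2)"
proof -
  define II where "II = metric_form (ds2 recip_log_deriv) p"
  \<comment> \<open>\<open>A\<close> applies the shape operator to a tangent vector.\<close>
  define A where "A w l = (\<Sum>i\<in>UNIV. shape l i p * w $ i)" for w :: "real^'n" and l
  have "riemann_curvature (ds2 f) p u v v $ l = - (1 / (4 * gap p)) * (A u l * II v v - A v l * II u v)" for l
  proof -
    have "riemann_curvature (ds2 f) p u v v $ l
      = - (1 / (4 * gap p)) * (\<Sum>i\<in>UNIV. \<Sum>j\<in>UNIV. \<Sum>k\<in>UNIV.
         (shape l i p * u $ i) * (ds2 recip_log_deriv p $ j $ k * v $ j * v $ k)
         - (shape l j p * v $ j) * (ds2 recip_log_deriv p $ i $ k * u $ i * v $ k))"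
      unfolding riemann_curvature_def riemann_coeff_ds2 sum_distrib_left
      by (simp add: algebra_simps)
    also have "(\<Sum>i\<in>UNIV. \<Sum>j\<in>UNIV. \<Sum>k\<in>UNIV.
         (shape l i p * u $ i) * (ds2 recip_log_deriv p $ j $ k * v $ j * v $ k)
         - (shape l j p * v $ j) * (ds2 recip_log_deriv p $ i $ k * u $ i * v $ k))
       = (\<Sum>i\<in>UNIV. (shape l i p * u $ i) * II v v) - (\<Sum>i\<in>UNIV. A v l * (\<Sum>k\<in>UNIV. ds2 recip_log_deriv p $ i $ k * u $ i * v $ k))"
      unfolding sum_subtractf
      by (simp add: II_def metric_form_def A_def sum_distrib_left[symmetric] sum_distrib_right[symmetric])
    also have "\<dots> = A u l * II v v - A v l * II u v"
      by (simp add: A_def II_def metric_form_def sum_distrib_left[symmetric] sum_distrib_right[symmetric])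
    finally show ?thesis .
  qed
  note R = this
  have A: "(\<Sum>l\<in>UNIV. \<Sum>r\<in>UNIV. ds2 f p $ l $ r * A w l * u $ r) = II w u" for w
  proof -
    have sym: "ds2 a p $ i $ j = ds2 a p $ j $ i" for a i j by (simp add: ds2_def)
    have "(\<Sum>l\<in>UNIV. \<Sum>r\<in>UNIV. ds2 f p $ l $ r * A w l * u $ r)
        = (\<Sum>r\<in>UNIV. \<Sum>l\<in>UNIV. \<Sum>i\<in>UNIV. ds2 f p $ r $ l * shape l i p * w $ i * u $ r)"
      unfolding A_def sum_distrib_left sum_distrib_right
      by (subst sum.swap) (simp add: sym[of f] mult.assoc)
    also have "\<dots> = (\<Sum>r\<in>UNIV. \<Sum>i\<in>UNIV. (\<Sum>l\<in>UNIV. ds2 f p $ r $ l * shape l i p) * w $ i * u $ r)"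
      unfolding sum_distrib_right by (rule sum.cong[OF refl], rule sum.swap)
    also have "\<dots> = II w u"
      unfolding ds2_shape II_def metric_form_def by (subst sum.swap) (simp add: sym[of recip_log_deriv])
    finally show ?thesis .
  qed
  have "metric_form (ds2 f) p (riemann_curvature (ds2 f) p u v v) u
      = - (1 / (4 * gap p)) * (II v v * (\<Sum>l\<in>UNIV. \<Sum>r\<in>UNIV. ds2 f p $ l $ r * A u l * u $ r)
         - II u v * (\<Sum>l\<in>UNIV. \<Sum>r\<in>UNIV. ds2 f p $ l $ r * A v l * u $ r))"
    unfolding metric_form_def R
    by (simp add: sum_distrib_left sum_subtractf[symmetric] algebra_simps)
  moreover have "II v u = II u v" by (simp add: II_def metric_form_ds2 mult.commute)
  ultimately show ?thesis unfolding A by (simp add: II_def power2_eq_square)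
qed

end

text \<open>
  In the Gauss equation, superadditivity of \<open>f / f'\<close> makes the second fundamental form definite.
\<close>

lemma sectional_curvature_ds2_neg:
  fixes p :: "real^'n"
  assumes p: "p \<in> positive_orthant" and dim: "CARD('n) \<ge> 2"
    and superadd_recip: "\<And>x y. x > 0 \<Longrightarrow> y > 0 \<Longrightarrow>
      recip_log_deriv x + recip_log_deriv y < recip_log_deriv (x + y)"
    and indep: "independent {u, v}" "u \<noteq> v"
  shows "sectional_curvature (ds2 f) p u v < 0"
proof -
  have "(metric_form (ds2 f) p u v)\<^sup>2 < metric_form (ds2 f) p u u * metric_form (ds2 f) p v v"
    using superadditive_sum[of f UNIV "($) p"] superadd dim
    by (intro metric_form_ds2_gram_pos pos coord_pos[OF p dim] indep) (auto simp: coord_pos[OF p dim])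
  moreover have "(metric_form (ds2 recip_log_deriv) p u v)\<^sup>2
      < metric_form (ds2 recip_log_deriv) p u u * metric_form (ds2 recip_log_deriv) p v v"
    using superadditive_sum[of recip_log_deriv UNIV "($) p"] superadd_recip dim
    by (intro metric_form_ds2_gram_pos indep)
      (auto simp: coord_pos[OF p dim] recip_log_deriv_def pos deriv_pos)
  ultimately show ?thesis
    unfolding sectional_curvature_def gauss_equation[OF p dim]
    using gap_pos[OF p dim] by (intro divide_neg_pos mult_neg_pos) auto
qed

end

section \<open>Negativity of the curvature\<close>

lemma smooth_on_DERIV:
  assumes "smooth_on S f" "open S" "x \<in> S"
  shows "((deriv ^^ k) f has_real_derivative (deriv ^^ Suc k) f x) (at x)"
proof -
  have "(deriv ^^ k) f differentiable at x"
    using assms by (auto simp: smooth_on_def differentiable_on_eq_differentiable_at)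
  then show ?thesis by (simp add: DERIV_deriv_iff_real_differentiable)
qed

lemma tendsto_zero_of_bigo:
  fixes a b :: "real \<Rightarrow> real"
  assumes "a \<in> O[F](b)" and "(b \<longlongrightarrow> 0) F"
  shows "(a \<longlongrightarrow> 0) F"
proof -
  obtain c where "\<forall>\<^sub>F x in F. norm (a x) \<le> c * norm (b x)"
    using landau_o.bigE[OF assms(1)] by blast
  moreover have "((\<lambda>x. c * norm (b x)) \<longlongrightarrow> 0) F"
    using tendsto_mult_right_zero[OF tendsto_norm_zero[OF assms(2)]] .
  ultimately show ?thesis by (rule Lim_null_comparison)
qed

text \<open>
  Being increasing, \<open>f'\<close> and then \<open>f\<close> exceed their vanishing limits at the origin.  For the last
  conclusion, \<open>f / f'\<close> lies between \<open>0\<close> and the identity: the function \<open>x f'(x) - f(x)\<close>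
  tends to zero at the origin and has the positive derivative \<open>x f''(x)\<close>.
\<close>

lemma convex_vanishing_at_origin:
  fixes f f' f'' :: "real \<Rightarrow> real"
  assumes d1: "\<And>x. x > 0 \<Longrightarrow> (f has_real_derivative f' x) (at x)"
    and d2: "\<And>x. x > 0 \<Longrightarrow> (f' has_real_derivative f'' x) (at x)"
    and convex: "\<And>x. x > 0 \<Longrightarrow> f'' x > 0"
    and lim: "(f \<longlongrightarrow> 0) (at_right 0)" "(f' \<longlongrightarrow> 0) (at_right 0)"
  shows "\<And>x. x > 0 \<Longrightarrow> f' x > 0"
    and "\<And>x. x > 0 \<Longrightarrow> f x > 0"
    and "\<And>x y. x > 0 \<Longrightarrow> y > 0 \<Longrightarrow> f x + f y < f (x + y)"
    and "((\<lambda>x. f x / f' x) \<longlongrightarrow> 0) (at_right 0)"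
proof -
  have mono': "strict_mono_on {0<..} f'"
    using d2 convex by (rule strict_mono_on_of_deriv_pos)
  show f'_pos: "f' x > 0" if "x > 0" for x
    using strict_mono_on_gt_right_limit[OF mono' lim(2) that] .
  have "strict_mono_on {0<..} f"
    using d1 f'_pos by (rule strict_mono_on_of_deriv_pos)
  from strict_mono_on_gt_right_limit[OF this lim(1)]
  show f_pos: "f x > 0" if "x > 0" for x using that .
  show "f x + f y < f (x + y)" if "x > 0" "y > 0" for x y
    using superadditive_of_strict_mono_deriv[OF d1 mono' lim(1) that] .
  have "strict_mono_on {0<..} (\<lambda>x. x * f' x - f x)"
  proof (rule strict_mono_on_of_deriv_pos)
    fix x :: real
    assume "x > 0"
    then show "((\<lambda>x. x * f' x - f x) has_real_derivative x * f'' x) (at x)"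
      by (auto intro!: derivative_eq_intros d1 d2)
    show "x * f'' x > 0" using \<open>x > 0\<close> convex by simp
  qed
  moreover have "((\<lambda>x. x * f' x - f x) \<longlongrightarrow> 0) (at_right 0)"
    using lim by (auto intro!: tendsto_eq_intros)
  ultimately have "x * f' x - f x > 0" if "x > 0" for x
    using that by (rule strict_mono_on_gt_right_limit)
  then have "0 \<le> f x / f' x \<and> f x / f' x \<le> x" if "x > 0" for x
    using that f_pos[OF that] f'_pos[OF that] by (simp add: pos_divide_le_eq less_imp_le)
  then have "\<forall>\<^sub>F x in at_right 0. 0 \<le> f x / f' x" "\<forall>\<^sub>F x in at_right 0. f x / f' x \<le> x"
    by (auto intro!: eventually_at_rightI[of 0 1])
  then show "((\<lambda>x. f x / f' x) \<longlongrightarrow> 0) (at_right 0)"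
    by (rule tendsto_sandwich) (auto intro!: tendsto_eq_intros)
qed

theorem theorem6:
  fixes f :: "real \<Rightarrow> real"
  assumes "CARD('n::finite) \<ge> 2"
    and "smooth_on {0<..} f"
    and "f \<in> O[at_right 0](\<lambda>x. x^2)"
    and "deriv f \<in> O[at_right 0](\<lambda>x. x)"
    and "f \<in> O[at_top](\<lambda>x. x^2)"
    and "\<And>x. x > 0 \<Longrightarrow> (deriv ^^ 2) f x > 0"
    and "\<And>x. x > 0 \<Longrightarrow> (deriv ^^ 2) (\<lambda>y. f y / deriv f y) x > 0"
  shows "\<forall>p \<in> (positive_orthant :: (real^'n) set).
           \<forall>P :: (real^'n) set. subspace P \<and> dim P = 2 \<longrightarrow>
             (\<forall>u v. independent {u, v} \<and> span {u, v} = P \<longrightarrow>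
                sectional_curvature (ds2 f) p u v < 0)"
proof (intro ballI allI impI)
  fix p :: "real^'n" and P :: "(real^'n) set" and u v
  assume p: "p \<in> positive_orthant" and "subspace P \<and> dim P = 2"
    and uv: "independent {u, v} \<and> span {u, v} = P"
  then have "dim {u, v} = 2"
    by (metis dim_span)
  then have "card {u, v} = 2"
    using dim_eq_card_independent[of "{u, v}"] uv by simp
  then have "u \<noteq> v" by auto

  note D = smooth_on_DERIV[OF assms(2) open_greaterThan]
  have d1: "(f has_real_derivative deriv f x) (at x)" if "x > 0" for x
    using D[of x 0] that by simp
  have d2: "(deriv f has_real_derivative deriv (deriv f) x) (at x)" if "x > 0" for x
    using D[of x 1] that by simp
  have d3: "(deriv (deriv f) has_real_derivative deriv (deriv (deriv f)) x) (at x)" if "x > 0" for x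
    using D[of x 2] that by (simp add: numeral_2_eq_2)
  have convex: "deriv (deriv f) x > 0" if "x > 0" for x
    using assms(6)[OF that] by (simp add: numeral_2_eq_2)
  have lim: "(f \<longlongrightarrow> 0) (at_right 0)"
    using assms(3) by (rule tendsto_zero_of_bigo) (auto intro!: tendsto_eq_intros)
  have lim': "(deriv f \<longlongrightarrow> 0) (at_right 0)"
    using assms(4) by (rule tendsto_zero_of_bigo) (auto intro!: tendsto_eq_intros)
  have f'_pos: "deriv f x > 0" if "x > 0" for x
    by (rule convex_vanishing_at_origin(1)[OF d1 d2 convex lim lim' that])
  have f_pos: "f x > 0" if "x > 0" for x
    by (rule convex_vanishing_at_origin(2)[OF d1 d2 convex lim lim' that])
  have superadd_f: "f x + f y < f (x + y)" if "x > 0" "y > 0" for x y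
    by (rule convex_vanishing_at_origin(3)[OF d1 d2 convex lim lim' that])
  have lim_ratio: "((\<lambda>x. f x / deriv f x) \<longlongrightarrow> 0) (at_right 0)"
    by (rule convex_vanishing_at_origin(4)[OF d1 d2 convex lim lim'])

  interpret superadditive_profile f "deriv f" "deriv (deriv f)"
    using f_pos f'_pos superadd_f d1 d2 by unfold_locales

  define h' where "h' x = (deriv f x * deriv f x - f x * deriv (deriv f) x) / (deriv f x * deriv f x)" for x
  have h: "(recip_log_deriv has_real_derivative h' x) (at x)" if "x > 0" for x
    unfolding recip_log_deriv_def h'_def
    using DERIV_divide[OF d1[OF that] d2[OF that]] f'_pos[OF that] by simp
  have "strict_mono_on {0<..} h'"
  proof (rule strict_mono_on_of_deriv_pos)
    fix x :: real
    assume "x > 0"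
    then have "f differentiable at x" "deriv f differentiable at x" "deriv (deriv f) differentiable at x"
      using d1 d2 d3 real_differentiable_def by blast+
    then have "h' differentiable at x"
      unfolding h'_def using f'_pos[OF \<open>x > 0\<close>]
      by (intro differentiable_divide differentiable_diff differentiable_mult) auto
    then show "(h' has_real_derivative deriv h' x) (at x)"
      by (simp add: DERIV_deriv_iff_real_differentiable)
    have "\<forall>\<^sub>F y in nhds x. y \<in> {0<..}"
      using \<open>x > 0\<close> by (intro eventually_nhds_in_open) auto
    then have "\<forall>\<^sub>F y in nhds x. deriv recip_log_deriv y = h' y"
      by eventually_elim (use h DERIV_imp_deriv in auto)
    then have "deriv h' x = deriv (deriv recip_log_deriv) x"
      by (intro deriv_cong_ev[symmetric]) auto
    also have "\<dots> > 0"
      using assms(7)[OF \<open>x > 0\<close>] by (simp add: numeral_2_eq_2 recip_log_deriv_def[abs_def])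
    finally show "deriv h' x > 0" .
  qed
  moreover have "(recip_log_deriv \<longlongrightarrow> 0) (at_right 0)"
    using lim_ratio by (simp add: recip_log_deriv_def[abs_def])
  ultimately have "recip_log_deriv x + recip_log_deriv y < recip_log_deriv (x + y)" if "x > 0" "y > 0" for x y
    using superadditive_of_strict_mono_deriv[OF h] that by blast
  then show "sectional_curvature (ds2 f) p u v < 0"
    using uv \<open>u \<noteq> v\<close> by (intro sectional_curvature_ds2_neg[OF p assms(1)]) auto
qed

end
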